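(* Let $N=|X\setminus A|$ and fix $t>0$. As $R\to\infty$, the Lipschitz constants of the random feature maps $\Phi_{t,R}:K(X,A)\to\mathbb R^{2R}$ satisfy $$\mathrm{Lip}(\Phi_{t,R})\;\le\;\frac{\pi}{d_{\min}\sqrt{2\,w_{\min}}}\left(\int_{\mathbb T^{N}}\lambda(\theta)\,e^{-t\lambda(\theta)}\,d\mu(\theta)\right)^{1/2}+o_{\mathbb P}(1).$$
   Context: Lipschitz seminorm: for a map $f:(M_1,\rho_1)\to(M_2,\rho_2)$ of metric spaces, $\mathrm{Lip}(f):=\sup_{\alpha\ne\beta}\rho_2(f(\alpha),f(\beta))/\rho_1(\alpha,\beta)\in[0,\infty]$. Setting: $(X,d)$ is a metric space and $A\subseteq X$ is nonempty with $X\setminus A=\{x_1,\dots,x_N\}$ finite, $N\ge1$. Write $d(x,A)=\inf_{a\in A}d(x,a)$ and $d_1(x,y):=\min\{d(x,y),\,d(x,A)+d(y,A)\}$. Let $X/A=\{[A],x_1,\dots,x_N\}$ be the quotient collapsing $A$ to the basepoint $[A]$, and let $\overline d_1$ be the function on $X/A$ induced by $d_1$; it is assumed to be a metric on $X/A$ (equivalently $d(x_j,A)>0$ for all $j$). Diagrams: $D(X,A)$ is the free commutative monoid on $X\setminus A$ (finite multisets of points of $X\setminus A$; the point $[A]$ is identified with $0$). For $\alpha,\beta\in D(X,A)$, $W_1(\alpha,\beta)$ is the infimum of $\sum_{i}\overline d_1(u_i,v_i)$ over all finite multisets $\{(u_i,v_i)\}_i$ of pairs in $(X/A)\times(X/A)$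 such that $\sum_i u_i$ equals $\alpha$ and $\sum_i v_i$ equals $\beta$ modulo multiples of $[A]$. $K(X,A)$ is the Grothendieck group of $D(X,A)$, identified with the free abelian group $\mathbb Z^{N}$ with basis $e_1,\dots,e_N$, where $e_j$ is the class of $x_j$. It carries the translation-invariant metric $\rho(a-b,c-e):=W_1(a+e,c+b)$ for $a,b,c,e\in D(X,A)$. Phases: $\mathbb T^{N}=\mathbb R^{N}/2\pi\mathbb Z^{N}$ with normalized Haar (Lebesgue) probability measure $\mu$. For $\alpha=\sum_j n_je_j\in K(X,A)$ and $\theta\in\mathbb T^N$, $\langle\alpha,\theta\rangle=\sum_j n_j\theta_j$ (mod $2\pi$). The phase function $\phi_\theta:X/A\to S^1\subset\mathbb C$ is $\phi_\theta([A])=1$, $\phi_\theta(x_j)=e^{i\theta_j}$. Graph model: fix a connected (simple, undirected) graph $H=(V,E)$ with $V=X/A$ such that, when each edge $\{u,v\}$ is given length $\overline d_1(u,v)$, the shortest-path metric of $H$ is $\overline d_1$. Fix symmetric conductances $w_{uv}=w_{vu}>0$ for $\{u,v\}\in E$ (not necessarily equal to the lengths), with $w_{uv}=0$ if $\{u,v\}\notin E$. The Dirichlet energy is $\lambda(\theta):=\tfrac12\sum_{u,v\in V}w_{uv}|\phi_\theta(u)-\phi_\theta(v)|^2$, with $|\cdot|$ the complex modulus. Put $w_{\min}=\min_{\{u,v\}\in E}w_{uv}$ and $d_{\min}=\min_{\{u,v\}\in E}\overline d_1(u,v)$. Random features: for $t>0$, $d\nu_t(\theta)=e^{-t\lambda(\theta)}d\mu(\theta)$.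 For $R\in\mathbb N$, $R\ge 1$, let $\theta^{(1)},\dots,\theta^{(R)}$ be independent samples from the probability measure $\nu_t/\nu_t(\mathbb T^N)$ and $$\Phi_{t,R}(\alpha):=\sqrt{\frac{\nu_t(\mathbb T^N)}{R}}\,\bigl(\cos\langle\alpha,\theta^{(r)}\rangle,\ \sin\langle\alpha,\theta^{(r)}\rangle\bigr)_{r=1}^R\in\mathbb R^{2R}.$$ $\mathrm{Lip}(\Phi_{t,R})$ is taken with respect to $\rho$ and the Euclidean metric on $\mathbb R^{2R}$. The term $o_{\mathbb P}(1)$ denotes a sequence (indexed by $R$) of random variables converging to $0$ in probability as $R\to\infty$. *)

theory Defs
  imports
    "HOL-Probability.Probability"
    "HOL-Library.Poly_Mapping"
    "Graph_Theory.Pair_Digraph"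
    "Graph_Theory.Digraph_Component"
    "Graph_Theory.Shortest_Path"
begin

section \<open>Lipschitz seminorm\<close>

text \<open>For functions between sets with given distances. At points with \<open>x \<noteq> y\<close> but
  \<open>\<rho>1 x y = 0\<close> (impossible for a metric) the quotient is infinite or \<open>0 / 0 = 0\<close>.\<close>

definition Lip :: "'a set \<Rightarrow> ('a \<Rightarrow> 'a \<Rightarrow> real) \<Rightarrow> ('b \<Rightarrow> 'b \<Rightarrow> real) \<Rightarrow> ('a \<Rightarrow> 'b) \<Rightarrow> ennreal"
  where "Lip S \<rho>1 \<rho>2 f =
    (SUP (x, y) \<in> {(x, y). x \<in> S \<and> y \<in> S \<and> x \<noteq> y}.
       ennreal (\<rho>2 (f x) (f y)) / ennreal (\<rho>1 x y))"


section \<open>The quotient \<open>X/A\<close>\<close>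

text \<open>The metric space \<open>X\<close> is the whole type. A point of \<open>X/A\<close> is \<open>None\<close>, standing for the
  basepoint \<open>[A]\<close>, or \<open>Some x\<close> with \<open>x \<notin> A\<close>.\<close>

definition quot_points :: "'a set \<Rightarrow> 'a option set"
  where "quot_points A = insert None (Some ` (- A))"

definition quot_map :: "'a set \<Rightarrow> 'a \<Rightarrow> 'a option"
  where "quot_map A x = (if x \<in> A then None else Some x)"

definition d1 :: "'a::metric_space set \<Rightarrow> 'a \<Rightarrow> 'a \<Rightarrow> real"
  where "d1 A x y = min (dist x y) (infdist x A + infdist y A)"

fun d1_bar :: "'a::metric_space set \<Rightarrow> 'a option \<Rightarrow> 'a option \<Rightarrow> real" where
  "d1_bar A None None = 0"
| "d1_bar A None (Some y) = infdist y A"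
| "d1_bar A (Some x) None = infdist x A"
| "d1_bar A (Some x) (Some y) = d1 A x y"

text \<open>This is the function induced by \<open>d1\<close>:\<close>

lemma d1_bar_quot_map: "d1_bar A (quot_map A x) (quot_map A y) = d1 A x y"
proof -
  have "infdist z A \<le> dist a z" "infdist z A \<le> dist z a" if "a \<in> A" for a z
    using infdist_le[OF that, of z] by (simp_all add: dist_commute)
  then show ?thesis
    by (auto simp: quot_map_def d1_def min_def intro!: antisym)
qed


section \<open>Persistence diagrams and their Grothendieck group\<close>

definition diagrams :: "'a set \<Rightarrow> 'a multiset set"
  where "diagrams A = {\<alpha>. set_mset \<alpha> \<subseteq> - A}"

definition matchings :: "'a set \<Rightarrow> 'a multiset \<Rightarrow> 'a multiset \<Rightarrow> ('a option \<times> 'a option) multiset set"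
  where "matchings A \<alpha> \<beta> =
    {P. set_mset P \<subseteq> quot_points A \<times> quot_points A \<and>
        (\<exists>k. image_mset fst P = image_mset Some \<alpha> + replicate_mset k None) \<and>
        (\<exists>k. image_mset snd P = image_mset Some \<beta> + replicate_mset k None)}"

definition W1 :: "'a::metric_space set \<Rightarrow> 'a multiset \<Rightarrow> 'a multiset \<Rightarrow> real"
  where "W1 A \<alpha> \<beta> = (INF P \<in> matchings A \<alpha> \<beta>. \<Sum>p\<in>#P. d1_bar A (fst p) (snd p))"

definition K :: "'a set \<Rightarrow> ('a \<Rightarrow>\<^sub>0 int) set"
  where "K A = {\<alpha>. Poly_Mapping.keys \<alpha> \<subseteq> - A}"

text \<open>The class in \<open>K A\<close> of a diagram; \<open>frag_of x\<close> is the basis vector of \<open>x\<close>.\<close>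

definition diagram_class :: "'a multiset \<Rightarrow> ('a \<Rightarrow>\<^sub>0 int)"
  where "diagram_class \<alpha> = (\<Sum>x\<in>#\<alpha>. frag_of x)"

text \<open>The common value over all representations of \<open>\<alpha>\<close> and \<open>\<beta>\<close> as differences of diagrams.
  Lemmas \<open>K_eq_differences\<close> and \<open>rho_differences\<close> below show that such representations exist
  and that the value does not depend on them.\<close>

definition rho :: "'a::metric_space set \<Rightarrow> ('a \<Rightarrow>\<^sub>0 int) \<Rightarrow> ('a \<Rightarrow>\<^sub>0 int) \<Rightarrow> real"
  where "rho A \<alpha> \<beta> = (THE r. \<forall>a\<in>diagrams A. \<forall>b\<in>diagrams A. \<forall>c\<in>diagrams A. \<forall>e\<in>diagrams A.
    \<alpha> = diagram_class a - diagram_class b \<and> \<beta> = diagram_class c - diagram_class e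
      \<longrightarrow> r = W1 A (a + e) (c + b))"

lemma lookup_diagram_class: "Poly_Mapping.lookup (diagram_class a) x = int (count a x)"
  by (induction a) (auto simp: diagram_class_def lookup_add lookup_single when_def)

lemma diagram_class_add: "diagram_class (a + b) = diagram_class a + diagram_class b"
  by (simp add: diagram_class_def)

lemma inj_diagram_class: "inj diagram_class"
  by (rule injI, rule multiset_eqI) (metis lookup_diagram_class of_nat_eq_iff)

lemma K_eq_differences:
  "K A = {diagram_class a - diagram_class b | a b. a \<in> diagrams A \<and> b \<in> diagrams A}"
proof (intro set_eqI iffI)
  fix \<alpha> assume "\<alpha> \<in> K A"
  then have sub: "Poly_Mapping.keys \<alpha> \<subseteq> - A" by (simp add: K_def)
  define f where "f s = (\<Sum>x\<in>Poly_Mapping.keys \<alpha>. replicate_mset (nat (s * Poly_Mapping.lookup \<alpha> x)) x)" for s :: int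
  have cnt: "count (f s) x = nat (s * Poly_Mapping.lookup \<alpha> x)" for s x
  proof -
    have "count (f s) x = (\<Sum>y\<in>Poly_Mapping.keys \<alpha>. if y = x then nat (s * Poly_Mapping.lookup \<alpha> y) else 0)"
      unfolding f_def count_sum by (intro sum.cong) auto
    also have "\<dots> = nat (s * Poly_Mapping.lookup \<alpha> x)"
      by (auto simp: in_keys_iff)
    finally show ?thesis .
  qed
  have mem: "f s \<in> diagrams A" for s
  proof -
    have "x \<in> Poly_Mapping.keys \<alpha>" if "x \<in># f s" for x
      using that cnt[of s x] by (auto simp: in_keys_iff simp flip: count_greater_zero_iff)
    then show ?thesis using sub by (auto simp: diagrams_def)
  qed
  have "\<alpha> = diagram_class (f 1) - diagram_class (f (- 1))"
    by (rule poly_mapping_eqI) (simp add: lookup_minus lookup_diagram_class cnt)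
  then show "\<alpha> \<in> {diagram_class a - diagram_class b | a b. a \<in> diagrams A \<and> b \<in> diagrams A}"
    using mem by blast
next
  fix \<alpha> assume "\<alpha> \<in> {diagram_class a - diagram_class b | a b. a \<in> diagrams A \<and> b \<in> diagrams A}"
  then obtain a b where *: "\<alpha> = diagram_class a - diagram_class b" "a \<in> diagrams A" "b \<in> diagrams A"
    by blast
  have "x \<in># a \<or> x \<in># b" if "x \<in> Poly_Mapping.keys \<alpha>" for x
    using that by (auto simp: * in_keys_iff lookup_minus lookup_diagram_class)
      (metis count_eq_zero_iff)
  then show "\<alpha> \<in> K A" using *(2,3) by (auto simp: K_def diagrams_def)
qed

lemma d1_bar_nonneg: "0 \<le> d1_bar A u v"
  by (cases u; cases v) (auto simp: d1_def infdist_nonneg)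

lemma d1_bar_refl: "d1_bar A u u = 0"
  by (cases u) (auto simp: d1_def infdist_nonneg)

lemma d1_bar_triangle: "d1_bar A u v \<le> d1_bar A u z + d1_bar A z v"
proof -
  have *: "infdist x A \<le> infdist y A + dist x y" "infdist x A \<le> infdist y A + dist y x"
    "0 \<le> infdist x A" "dist x y \<le> dist x z + dist z y" for x y z :: 'a
    using infdist_triangle[of x A y] dist_triangle[of x y z]
    by (simp_all add: infdist_nonneg dist_commute)
  show ?thesis
  proof (cases u; cases v; cases z)
    fix x y p assume "u = Some x" "v = Some y" "z = Some p"
    then show ?thesis
      using *(1)[of x p] *(1)[of y p] *(2)[of y p] *(3)[of x] *(3)[of y] *(3)[of p] *(4)[of x y p]
      by (simp add: d1_def min_def)
  next
    fix x p assume "u = Some x" "v = None" "z = Some p"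
    then show ?thesis using *(1)[of x p] *(3)[of p] by (simp add: d1_def min_def)
  next
    fix y p assume "u = None" "v = Some y" "z = Some p"
    then show ?thesis using *(2)[of y p] *(3)[of p] by (simp add: d1_def min_def)
  qed (use *(3) in \<open>simp_all add: d1_def\<close>)
qed

lemma sum_mset_d1_bar_nonneg: "0 \<le> (\<Sum>p\<in>#P. d1_bar A (fst p) (snd p))"
  by (induction P) (auto simp: d1_bar_nonneg)

lemma matchings_nonempty:
  assumes "a \<in> diagrams A" "b \<in> diagrams A"
  shows "matchings A a b \<noteq> {}"
proof -
  let ?P = "image_mset (\<lambda>x. (Some x, None)) a + image_mset (\<lambda>x. (None, Some x)) b"
  have "image_mset fst ?P = image_mset Some a + replicate_mset (size b) None"
    "image_mset snd ?P = image_mset Some b + replicate_mset (size a) None"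
    by (simp_all add: multiset.map_comp o_def image_mset_const_eq)
  moreover have "set_mset ?P \<subseteq> quot_points A \<times> quot_points A"
    using assms by (auto simp: diagrams_def quot_points_def)
  ultimately have "?P \<in> matchings A a b"
    unfolding matchings_def by blast
  then show ?thesis by blast
qed

lemma W1_le: "P \<in> matchings A a b \<Longrightarrow> W1 A a b \<le> (\<Sum>p\<in>#P. d1_bar A (fst p) (snd p))"
  unfolding W1_def
  by (rule cINF_lower[OF bdd_belowI[of _ 0]]) (auto simp: sum_mset_d1_bar_nonneg)

lemma W1_greatest:
  assumes "a \<in> diagrams A" "b \<in> diagrams A"
    "\<And>P. P \<in> matchings A a b \<Longrightarrow> r \<le> (\<Sum>p\<in>#P. d1_bar A (fst p) (snd p))"
  shows "r \<le> W1 A a b"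
  unfolding W1_def using assms by (intro cINF_greatest matchings_nonempty) auto

lemma W1_add_mset:
  assumes "a \<in> diagrams A" "b \<in> diagrams A" "x \<notin> A"
  shows "W1 A (add_mset x a) (add_mset x b) = W1 A a b"
proof (rule antisym)
  show "W1 A (add_mset x a) (add_mset x b) \<le> W1 A a b"
  proof (rule W1_greatest[OF assms(1,2)])
    fix P assume "P \<in> matchings A a b"
    then have "add_mset (Some x, Some x) P \<in> matchings A (add_mset x a) (add_mset x b)"
      using assms(3) by (auto simp: matchings_def quot_points_def)
    from W1_le[OF this]
    show "W1 A (add_mset x a) (add_mset x b) \<le> (\<Sum>p\<in>#P. d1_bar A (fst p) (snd p))"
      by (simp add: d1_bar_refl)
  qed
  have dia: "add_mset x a \<in> diagrams A" "add_mset x b \<in> diagrams A"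
    using assms by (auto simp: diagrams_def)
  show "W1 A a b \<le> W1 A (add_mset x a) (add_mset x b)"
  proof (rule W1_greatest[OF dia])
    fix P assume P: "P \<in> matchings A (add_mset x a) (add_mset x b)"
    obtain k l where
      k: "image_mset fst P = add_mset (Some x) (image_mset Some a + replicate_mset k None)" and
      l: "image_mset snd P = add_mset (Some x) (image_mset Some b + replicate_mset l None)"
      using P by (auto simp: matchings_def)
    obtain p P' where p: "P = add_mset p P'" "fst p = Some x"
        "image_mset fst P' = image_mset Some a + replicate_mset k None"
      using msed_map_invR[OF k] by auto
    show "W1 A a b \<le> (\<Sum>p\<in>#P. d1_bar A (fst p) (snd p))"
    proof (cases "snd p = Some x")
      case True
      have "P' \<in> matchings A a b"
        using P p l True by (auto simp: matchings_def)
      from W1_le[OF this] show ?thesis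
        using p True by (simp add: d1_bar_refl)
    next
      case False
      have "Some x \<in># image_mset snd P'"
        using l p False
        by (metis image_mset_add_mset insert_noteq_member union_single_eq_member)
      then obtain q where q: "q \<in># P'" "snd q = Some x" by auto
      define Q where "Q = P' - {#q#}"
      have P': "P' = add_mset q Q" using q by (simp add: Q_def)
      have "add_mset (fst q, snd p) Q \<in> matchings A a b"
        using P p l q P' unfolding matchings_def by auto
      from W1_le[OF this]
      have "W1 A a b \<le> d1_bar A (fst q) (snd p) + (\<Sum>p\<in>#Q. d1_bar A (fst p) (snd p))" by simp
      also have "d1_bar A (fst q) (snd p) \<le> d1_bar A (fst q) (snd q) + d1_bar A (fst p) (snd p)"
        using d1_bar_triangle[of A "fst q" "snd p" "Some x"] p q by simp
      finally show ?thesis using p P' by simp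
    qed
  qed
qed

lemma diagrams_add: "a \<in> diagrams A \<Longrightarrow> b \<in> diagrams A \<Longrightarrow> a + b \<in> diagrams A"
  by (auto simp: diagrams_def)

lemma W1_add:
  assumes "a \<in> diagrams A" "b \<in> diagrams A" "s \<in> diagrams A"
  shows "W1 A (a + s) (b + s) = W1 A a b"
  using assms(3)
proof (induction s)
  case (add x s)
  then have "s \<in> diagrams A" "x \<notin> A" by (auto simp: diagrams_def)
  then show ?case
    using add.IH W1_add_mset[of "a + s" A "b + s" x] assms by (simp add: diagrams_add)
qed simp

lemma rho_differences:
  assumes "a \<in> diagrams A" "b \<in> diagrams A" "c \<in> diagrams A" "e \<in> diagrams A"
  shows "rho A (diagram_class a - diagram_class b) (diagram_class c - diagram_class e)
    = W1 A (a + e) (c + b)"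
  unfolding rho_def
proof (rule the_equality, intro ballI impI)
  fix a' b' c' e'
  assume D: "a' \<in> diagrams A" "b' \<in> diagrams A" "c' \<in> diagrams A" "e' \<in> diagrams A"
    and eq: "diagram_class a - diagram_class b = diagram_class a' - diagram_class b' \<and>
      diagram_class c - diagram_class e = diagram_class c' - diagram_class e'"
  have "diagram_class (a + b') = diagram_class (a' + b)" "diagram_class (c + e') = diagram_class (c' + e)"
    using eq by (auto simp: diagram_class_add algebra_simps)
  then have ab: "a + b' = a' + b" and ce: "c + e' = c' + e"
    using inj_diagram_class by (auto dest: injD)
  have "W1 A (a + e) (c + b) = W1 A ((a + e) + (b' + e')) ((c + b) + (b' + e'))"
    using D assms by (simp add: W1_add diagrams_add)
  also have "(a + e) + (b' + e') = (a' + e') + (b + e)"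
    using ab by (metis add.assoc add.commute)
  also have "(c + b) + (b' + e') = (c' + b') + (b + e)"
    using ce by (metis add.assoc add.commute)
  also have "W1 A ((a' + e') + (b + e)) ((c' + b') + (b + e)) = W1 A (a' + e') (c' + b')"
    using D assms by (simp add: W1_add diagrams_add)
  finally show "W1 A (a + e) (c + b) = W1 A (a' + e') (c' + b')" .
qed (use assms in blast)


section \<open>Phases and random features\<close>

text \<open>The torus of phases indexed by \<open>I\<close>, represented by the fundamental domain
  \<open>[0, 2\<pi>)\<close> in each coordinate, with its normalized Lebesgue measure.\<close>

definition torus :: "'a set \<Rightarrow> ('a \<Rightarrow> real) measure"
  where "torus I = PiM I (\<lambda>_. uniform_measure lborel {0..<2 * pi})"

definition pairing :: "'a set \<Rightarrow> ('a \<Rightarrow>\<^sub>0 int) \<Rightarrow> ('a \<Rightarrow> real) \<Rightarrow> real"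
  where "pairing A \<alpha> \<theta> = (\<Sum>x\<in>- A. of_int (Poly_Mapping.lookup \<alpha> x) * \<theta> x)"

fun phase :: "('a \<Rightarrow> real) \<Rightarrow> 'a option \<Rightarrow> complex" where
  "phase \<theta> None = 1"
| "phase \<theta> (Some x) = cis (\<theta> x)"

definition energy :: "'a set \<Rightarrow> ('a option \<Rightarrow> 'a option \<Rightarrow> real) \<Rightarrow> ('a \<Rightarrow> real) \<Rightarrow> real"
  where "energy A w \<theta> =
    1 / 2 * (\<Sum>u\<in>quot_points A. \<Sum>v\<in>quot_points A. w u v * (cmod (phase \<theta> u - phase \<theta> v))\<^sup>2)"

definition nu :: "'a set \<Rightarrow> ('a option \<Rightarrow> 'a option \<Rightarrow> real) \<Rightarrow> real \<Rightarrow> ('a \<Rightarrow> real) measure"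
  where "nu A w t = density (torus (- A)) (\<lambda>\<theta>. ennreal (exp (- t * energy A w \<theta>)))"

definition nu_total :: "'a set \<Rightarrow> ('a option \<Rightarrow> 'a option \<Rightarrow> real) \<Rightarrow> real \<Rightarrow> real"
  where "nu_total A w t = measure (nu A w t) (space (nu A w t))"

definition nu_normalized :: "'a set \<Rightarrow> ('a option \<Rightarrow> 'a option \<Rightarrow> real) \<Rightarrow> real \<Rightarrow> ('a \<Rightarrow> real) measure"
  where "nu_normalized A w t = scale_measure (1 / ennreal (nu_total A w t)) (nu A w t)"

text \<open>Vectors of length \<open>2 * R\<close> are functions on \<open>{..<2 * R}\<close>, and samples are numbered from \<open>0\<close>:
  entries \<open>2 * r\<close> and \<open>2 * r + 1\<close> are the cosine and sine for the sample \<open>\<theta> r\<close>.\<close>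

definition feature_map ::
  "'a set \<Rightarrow> ('a option \<Rightarrow> 'a option \<Rightarrow> real) \<Rightarrow> real \<Rightarrow> nat \<Rightarrow> (nat \<Rightarrow> 'a \<Rightarrow> real)
    \<Rightarrow> ('a \<Rightarrow>\<^sub>0 int) \<Rightarrow> nat \<Rightarrow> real"
  where "feature_map A w t R \<theta> \<alpha> i =
    sqrt (nu_total A w t / real R) *
      (if even i then cos (pairing A \<alpha> (\<theta> (i div 2))) else sin (pairing A \<alpha> (\<theta> (i div 2))))"

definition euclidean_dist :: "nat \<Rightarrow> (nat \<Rightarrow> real) \<Rightarrow> (nat \<Rightarrow> real) \<Rightarrow> real"
  where "euclidean_dist n x y = L2_set (\<lambda>i. x i - y i) {..<n}"

definition tendsto_0_in_probability :: "'w measure \<Rightarrow> (nat \<Rightarrow> 'w \<Rightarrow> real) \<Rightarrow> bool"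
  where "tendsto_0_in_probability M Z \<longleftrightarrow>
    (\<forall>n. Z n \<in> borel_measurable M) \<and>
    (\<forall>\<epsilon>>0. (\<lambda>n. measure M {\<omega> \<in> space M. \<bar>Z n \<omega>\<bar> > \<epsilon>}) \<longlonglongrightarrow> 0)"

end

theory Submission
  imports Defs
begin

text \<open>A single character \<open>\<alpha> \<mapsto> cis \<langle>\<alpha>,\<theta>\<rangle>\<close> is a product of phases, so telescoping a
  product of unit complex numbers along a matching, and along walks in \<open>H\<close>, bounds its Lipschitz
  constant by the largest ratio of chord to length over the edges of \<open>H\<close>. One edge term of the
  energy bounds its chord by \<open>sqrt (2 * \<lambda> / w_min)\<close>; since \<open>2 \<le> \<pi>\<close> the ratio is at most
  \<open>\<pi> / (d_min * sqrt (2 * w_min)) * sqrt \<lambda>\<close>. Hence \<open>Lip \<Phi>\<close> is at most that constant times the square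
  root of the empirical mean of \<open>nu_total * \<lambda>(\<theta>\<^sub>r)\<close>, and this mean converges in probability to its
  expectation \<open>\<integral> \<lambda> exp (- t * \<lambda>) d\<mu>\<close> by Hoeffding's inequality.\<close>

section \<open>Characters on diagrams and telescoping along matchings\<close>

text \<open>Factors are exchanged one at a time. All other factors have norm one, so trading
  \<open>f p\<close> for \<open>g p\<close> costs exactly \<open>norm (f p - g p)\<close>, and the
  costs add up.\<close>

lemma norm_prod_mset_diff_le:
  fixes f g :: "'b \<Rightarrow> 'c::{real_normed_div_algebra, comm_ring_1}"
  assumes "\<And>p. norm (f p) = 1" "\<And>p. norm (g p) = 1"
  shows "norm ((\<Prod>p\<in>#P. f p) - (\<Prod>p\<in>#P. g p)) \<le> (\<Sum>p\<in>#P. norm (f p - g p))"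
proof (induction P)
  case (add p P)
  have g1: "norm (\<Prod>p\<in>#P. g p) = 1"
    by (induction P) (simp_all add: norm_mult assms(2))
  have "f p * (\<Prod>p\<in>#P. f p) - g p * (\<Prod>p\<in>#P. g p)
      = f p * ((\<Prod>p\<in>#P. f p) - (\<Prod>p\<in>#P. g p)) + (f p - g p) * (\<Prod>p\<in>#P. g p)"
    by (simp add: algebra_simps)
  also have "norm \<dots> \<le> norm ((\<Prod>p\<in>#P. f p) - (\<Prod>p\<in>#P. g p)) + norm (f p - g p)"
    by (rule norm_triangle_le) (simp add: norm_mult assms(1) g1)
  finally show ?case
    using add.IH by simp
qed simp

lemma cmod_phase [simp]: "cmod (phase \<theta> u) = 1"
  by (cases u) simp_all

lemma finite_quot_points [simp]: "finite (- A) \<Longrightarrow> finite (quot_points A)"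
  by (simp add: quot_points_def)

lemma pairing_add: "pairing A (\<alpha> + \<beta>) \<theta> = pairing A \<alpha> \<theta> + pairing A \<beta> \<theta>"
  by (simp add: pairing_def lookup_add algebra_simps sum.distrib)

lemma pairing_diff: "pairing A (\<alpha> - \<beta>) \<theta> = pairing A \<alpha> \<theta> - pairing A \<beta> \<theta>"
  by (simp add: pairing_def lookup_minus algebra_simps sum_subtractf)

lemma pairing_frag_of:
  assumes "finite (- A)" "x \<notin> A"
  shows "pairing A (frag_of x) \<theta> = \<theta> x"
proof -
  have "pairing A (frag_of x) \<theta> = (\<Sum>y\<in>- A. if y = x then \<theta> x else 0)"
    unfolding pairing_def by (intro sum.cong) (auto simp: lookup_single when_def)
  then show ?thesis
    using assms by simp
qed

lemma cis_pairing_diagram_class: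
  assumes "finite (- A)" "a \<in> diagrams A"
  shows "cis (pairing A (diagram_class a) \<theta>) = (\<Prod>x\<in>#a. cis (\<theta> x))"
  using assms(2)
proof (induction a)
  case empty
  then show ?case by (simp add: diagram_class_def pairing_def)
next
  case (add x a)
  then have "x \<notin> A" "a \<in> diagrams A" by (auto simp: diagrams_def)
  moreover have "diagram_class (add_mset x a) = frag_of x + diagram_class a"
    by (simp add: diagram_class_def)
  ultimately show ?case
    using add.IH by (simp add: pairing_add pairing_frag_of[OF assms(1)] cis_mult[symmetric])
qed

text \<open>The padding copies of \<open>None\<close> have phase 1, so the product over one side of
  a matching depends only on the diagram matched there, not on the multiple of the
  basepoint.\<close>

lemma prod_mset_phase_matching:
  assumes "P \<in> matchings A a b"
  shows "(\<Prod>p\<in>#P. phase \<theta> (fst p)) = (\<Prod>x\<in>#a. cis (\<theta> x))"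
    and "(\<Prod>p\<in>#P. phase \<theta> (snd p)) = (\<Prod>x\<in>#b. cis (\<theta> x))"
proof -
  have *: "(\<Prod>p\<in>#P. phase \<theta> (h p)) = (\<Prod>x\<in>#c. cis (\<theta> x))"
    if "image_mset h P = image_mset Some c + replicate_mset k None" for h c k
  proof -
    have "(\<Prod>p\<in>#P. phase \<theta> (h p)) = prod_mset (image_mset (phase \<theta>) (image_mset h P))"
      by (simp add: multiset.map_comp o_def)
    also have "\<dots> = (\<Prod>x\<in>#c. cis (\<theta> x))"
      unfolding that by (simp add: multiset.map_comp o_def)
    finally show ?thesis .
  qed
  from assms obtain k l where "image_mset fst P = image_mset Some a + replicate_mset k None"
      "image_mset snd P = image_mset Some b + replicate_mset l None"
    by (auto simp: matchings_def)
  then show "(\<Prod>p\<in>#P. phase \<theta> (fst p)) = (\<Prod>x\<in>#a. cis (\<theta> x))"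
      "(\<Prod>p\<in>#P. phase \<theta> (snd p)) = (\<Prod>x\<in>#b. cis (\<theta> x))"
    by (auto intro: *)
qed

text \<open>Every matching gives an upper bound by telescoping, and the left-hand side does not
  depend on the matching, so the bound passes to the infimum \<open>W1\<close>.\<close>

lemma cmod_prod_mset_cis_diff_le:
  assumes "0 \<le> L"
    and "\<And>u v. u \<in> quot_points A \<Longrightarrow> v \<in> quot_points A \<Longrightarrow>
      cmod (phase \<theta> u - phase \<theta> v) \<le> L * d1_bar A u v"
    and "a \<in> diagrams A" "b \<in> diagrams A"
  shows "cmod ((\<Prod>x\<in>#a. cis (\<theta> x)) - (\<Prod>x\<in>#b. cis (\<theta> x))) \<le> L * W1 A a b"
proof -
  let ?c = "cmod ((\<Prod>x\<in>#a. cis (\<theta> x)) - (\<Prod>x\<in>#b. cis (\<theta> x)))"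
  have le: "?c \<le> L * (\<Sum>p\<in>#P. d1_bar A (fst p) (snd p))" if P: "P \<in> matchings A a b" for P
  proof -
    have "?c \<le> (\<Sum>p\<in>#P. cmod (phase \<theta> (fst p) - phase \<theta> (snd p)))"
      using norm_prod_mset_diff_le[of "\<lambda>p. phase \<theta> (fst p)" "\<lambda>p. phase \<theta> (snd p)" P]
      by (simp add: prod_mset_phase_matching[OF P])
    also have "\<dots> \<le> (\<Sum>p\<in>#P. L * d1_bar A (fst p) (snd p))"
      using P by (intro sum_mset_mono assms(2)) (auto simp: matchings_def)
    finally show ?thesis
      by (simp add: sum_mset_distrib_left)
  qed
  show ?thesis
  \<comment> \<open>The infimum is reached by dividing by \<open>L\<close>. When
    \<open>L = 0\<close>, a single matching already forces the difference to vanish.\<close>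
  proof (cases "L = 0")
    case True
    then show ?thesis
      using le matchings_nonempty[OF assms(3,4)] by force
  next
    case False
    then have "0 < L" using assms(1) by simp
    then have "?c / L \<le> W1 A a b"
      using le by (intro W1_greatest assms) (simp add: field_simps)
    then show ?thesis using \<open>0 < L\<close> by (simp add: field_simps)
  qed
qed

lemma cmod_cis_pairing_diff_le:
  assumes fin: "finite (- A)" and L: "0 \<le> L"
    "\<And>u v. u \<in> quot_points A \<Longrightarrow> v \<in> quot_points A \<Longrightarrow>
      cmod (phase \<theta> u - phase \<theta> v) \<le> L * d1_bar A u v"
    and K: "\<alpha> \<in> K A" "\<beta> \<in> K A"
  shows "cmod (cis (pairing A \<alpha> \<theta>) - cis (pairing A \<beta> \<theta>)) \<le> L * rho A \<alpha> \<beta>"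
proof -
  obtain a b c e where D: "a \<in> diagrams A" "b \<in> diagrams A" "c \<in> diagrams A" "e \<in> diagrams A"
    and eq: "\<alpha> = diagram_class a - diagram_class b" "\<beta> = diagram_class c - diagram_class e"
    using K by (auto simp: K_eq_differences)
  \<comment> \<open>Multiplication by the unit number \<open>cis s\<close> clears the negative parts
    \<open>b\<close> and \<open>e\<close>. The two characters become products over
    \<open>a + e\<close> and \<open>c + b\<close>, the very diagrams whose \<open>W1\<close>
    distance is \<open>rho\<close>.\<close>
  define s where "s = pairing A (diagram_class b) \<theta> + pairing A (diagram_class e) \<theta>"
  have s: "cis (pairing A \<alpha> \<theta>) * cis s = cis (pairing A (diagram_class (a + e)) \<theta>)"
      "cis (pairing A \<beta> \<theta>) * cis s = cis (pairing A (diagram_class (c + b)) \<theta>)"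
    by (simp_all add: eq s_def cis_mult pairing_diff pairing_add diagram_class_add algebra_simps)
  have "cmod (cis (pairing A \<alpha> \<theta>) - cis (pairing A \<beta> \<theta>))
      = cmod ((cis (pairing A \<alpha> \<theta>) - cis (pairing A \<beta> \<theta>)) * cis s)"
    by (simp add: norm_mult)
  also have "\<dots> = cmod ((\<Prod>x\<in>#a + e. cis (\<theta> x)) - (\<Prod>x\<in>#c + b. cis (\<theta> x)))"
    using D by (simp only: left_diff_distrib s cis_pairing_diagram_class[OF fin] diagrams_add)
  also have "\<dots> \<le> L * W1 A (a + e) (c + b)"
    using L D by (intro cmod_prod_mset_cis_diff_le) (simp_all add: diagrams_add)
  also have "\<dots> = L * rho A \<alpha> \<beta>"
    unfolding eq by (simp add: rho_differences D)
  finally show ?thesis .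
qed

section \<open>From edges of the graph to all pairs of points\<close>

text \<open>Edge bounds add up along a walk by the triangle inequality. The shortest-path value is
  an infimum over walks; instead of showing that it is attained, the proof takes a walk of cost less
  than \<open>d + e'\<close> and lets the slack go to zero.\<close>

lemma (in pair_wf_digraph) dist_le_mult_shortest_path:
  fixes f :: "'a \<Rightarrow> 'b::metric_space" and c :: "'a \<times> 'a \<Rightarrow> real"
  assumes "0 \<le> L" "\<And>x y. (x, y) \<in> parcs G \<Longrightarrow> dist (f x) (f y) \<le> L * c (x, y)"
    and "\<mu> c u v = ereal d"
  shows "dist (f u) (f v) \<le> L * d"
proof (rule field_le_epsilon)
  fix e :: real assume "e > 0"
  \<comment> \<open>Dividing by \<open>L + 1\<close> instead of \<open>L\<close> also covers
    \<open>L = 0\<close>.\<close>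
  define e' where "e' = e / (L + 1)"
  have e': "e' > 0" "L * e' \<le> e"
    using \<open>e > 0\<close> assms(1) by (simp_all add: e'_def field_simps)
  have walk: "dist (f u) (f v) \<le> L * awalk_cost c p" if "awalk u p v" for u p
    using that
  proof (induction p arbitrary: u)
    case Nil
    then show ?case by (simp add: awalk_Nil_iff)
  next
    case (Cons a p)
    then have "a \<in> parcs G" "u = fst a" "awalk (snd a) p v"
      by (auto simp: awalk_Cons_iff)
    then show ?case
      using Cons.IH[of "snd a"] assms(2)[of "fst a" "snd a"] dist_triangle[of "f u" "f v" "f (snd a)"]
      by (simp add: algebra_simps)
  qed
  have "\<mu> c u v < ereal (d + e')"
    using e' by (simp add: assms(3))
  then obtain p where p: "awalk u p v" "awalk_cost c p < d + e'"
    by (auto simp: \<mu>_def INF_less_iff)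
  have "dist (f u) (f v) \<le> L * (d + e')"
    using walk[OF p(1)] mult_left_mono[OF less_imp_le[OF p(2)] assms(1)] by linarith
  then show "dist (f u) (f v) \<le> L * d + e"
    using e' by (simp add: algebra_simps)
qed

section \<open>Bounds for the Dirichlet energy\<close>

lemma energy_nonneg:
  assumes "\<And>u v. u \<in> quot_points A \<Longrightarrow> v \<in> quot_points A \<Longrightarrow> 0 \<le> w u v"
  shows "0 \<le> energy A w \<theta>"
  unfolding energy_def using assms by (auto intro!: sum_nonneg)

text \<open>All terms of the double sum are nonnegative, so each is at most the whole; the 2 undoes
  the factor 1/2. Keeping only one orientation of an edge is affordable, as the constant in the
  theorem leaves room for it.\<close>

lemma edge_term_le_energy:
  assumes "finite (- A)" and "u \<in> quot_points A" "v \<in> quot_points A"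
    and "\<And>u v. u \<in> quot_points A \<Longrightarrow> v \<in> quot_points A \<Longrightarrow> 0 \<le> w u v"
  shows "w u v * (cmod (phase \<theta> u - phase \<theta> v))\<^sup>2 \<le> 2 * energy A w \<theta>"
proof -
  let ?g = "\<lambda>u v. w u v * (cmod (phase \<theta> u - phase \<theta> v))\<^sup>2"
  have "?g u v \<le> (\<Sum>v\<in>quot_points A. ?g u v)"
    using assms by (intro member_le_sum) auto
  also have "\<dots> \<le> (\<Sum>u\<in>quot_points A. \<Sum>v\<in>quot_points A. ?g u v)"
    using assms by (intro member_le_sum[where f="\<lambda>u. \<Sum>v\<in>quot_points A. ?g u v"])
      (auto intro!: sum_nonneg)
  finally show ?thesis by (simp add: energy_def)
qed

text \<open>Chords of the unit circle have length at most 2. The uniform bound serves twice: it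
  keeps the total mass of \<open>nu\<close> positive and makes the samples bounded for Hoeffding's
  inequality.\<close>

lemma energy_le:
  assumes "\<And>u v. u \<in> quot_points A \<Longrightarrow> v \<in> quot_points A \<Longrightarrow> 0 \<le> w u v"
  shows "energy A w \<theta> \<le> 2 * (\<Sum>u\<in>quot_points A. \<Sum>v\<in>quot_points A. w u v)"
proof -
  have "(cmod (phase \<theta> u - phase \<theta> v))\<^sup>2 \<le> 2\<^sup>2" for u v
    using norm_triangle_ineq4[of "phase \<theta> u" "phase \<theta> v"] by (intro power_mono) auto
  then have "(\<Sum>u\<in>quot_points A. \<Sum>v\<in>quot_points A. w u v * (cmod (phase \<theta> u - phase \<theta> v))\<^sup>2)
      \<le> (\<Sum>u\<in>quot_points A. \<Sum>v\<in>quot_points A. w u v * 4)"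
    using assms by (intro sum_mono mult_left_mono) auto
  also have "\<dots> = 4 * (\<Sum>u\<in>quot_points A. \<Sum>v\<in>quot_points A. w u v)"
    by (simp add: sum_distrib_left mult.commute)
  finally show ?thesis by (simp add: energy_def)
qed

section \<open>The torus and measurability of the energy\<close>

lemma prob_space_torus: "prob_space (torus I)"
  unfolding torus_def by (intro prob_space_PiM prob_space_uniform_measure) auto

lemma measurable_phase [measurable]:
  assumes "u \<in> quot_points A"
  shows "(\<lambda>\<theta>. phase \<theta> u) \<in> borel_measurable (torus (- A))"
proof (cases u)
  case (Some x)
  then have "x \<in> - A" using assms by (auto simp: quot_points_def)
  then have "(\<lambda>\<theta>. \<theta> x) \<in> borel_measurable (torus (- A))"
    unfolding torus_def using measurable_component_singleton[of x "- A"
      "\<lambda>_. uniform_measure lborel {0..<2 * pi}"] by simp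
  moreover have "cis \<in> borel_measurable borel"
    by (intro borel_measurable_continuous_onI continuous_intros)
  ultimately show ?thesis
    using Some by simp
qed simp

lemma measurable_energy [measurable]: "energy A w \<in> borel_measurable (torus (- A))"
  unfolding energy_def by measurable

section \<open>The Lipschitz seminorm of the feature map for fixed samples\<close>

text \<open>The cosine and sine entries of one sample are the real and imaginary parts of its
  character, so grouping even and odd indices turns the Euclidean distance into a sum of squared
  chords.\<close>

lemma euclidean_dist_feature_map:
  assumes "0 \<le> nu_total A w t"
  shows "(euclidean_dist (2 * R) (feature_map A w t R \<theta> \<alpha>) (feature_map A w t R \<theta> \<beta>))\<^sup>2
    = nu_total A w t / real R *
      (\<Sum>r<R. (cmod (cis (pairing A \<alpha> (\<theta> r)) - cis (pairing A \<beta> (\<theta> r))))\<^sup>2)"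
proof -
  let ?F = "\<lambda>i. (feature_map A w t R \<theta> \<alpha> i - feature_map A w t R \<theta> \<beta> i)\<^sup>2"
  have split: "(\<Sum>i<2 * n. ?F i) = (\<Sum>r<n. ?F (2 * r) + ?F (2 * r + 1))" for n
    by (induction n) simp_all
  have pair: "?F (2 * r) + ?F (2 * r + 1) = nu_total A w t / real R *
      (cmod (cis (pairing A \<alpha> (\<theta> r)) - cis (pairing A \<beta> (\<theta> r))))\<^sup>2" for r
    using assms
    by (simp add: feature_map_def cmod_power2 power_mult_distrib distrib_left flip: right_diff_distrib)
  have "(euclidean_dist (2 * R) (feature_map A w t R \<theta> \<alpha>) (feature_map A w t R \<theta> \<beta>))\<^sup>2
      = (\<Sum>i<2 * R. ?F i)"
    by (simp add: euclidean_dist_def L2_set_def sum_nonneg)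
  then show ?thesis
    unfolding split pair sum_distrib_left .
qed

lemma Lip_le:
  assumes "0 \<le> L" and "\<And>x y. x \<in> S \<Longrightarrow> y \<in> S \<Longrightarrow> \<rho>2 (f x) (f y) \<le> L * \<rho>1 x y"
  shows "Lip S \<rho>1 \<rho>2 f \<le> ennreal L"
  unfolding Lip_def
proof (rule SUP_least, clarify)
  fix x y assume xy: "x \<in> S" "y \<in> S"
  have le: "\<rho>2 (f x) (f y) \<le> L * \<rho>1 x y" by (rule assms(2)[OF xy])
  show "ennreal (\<rho>2 (f x) (f y)) / ennreal (\<rho>1 x y) \<le> ennreal L"
  proof (cases "\<rho>1 x y > 0")
    case True
    show ?thesis
    proof (cases "\<rho>2 (f x) (f y) \<ge> 0")
      case nonneg: True
      then show ?thesis
        using True le by (simp add: divide_ennreal field_simps ennreal_leI)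
    next
      case False
      then show ?thesis by (simp add: ennreal_neg)
    qed
  next
    \<comment> \<open>Here the denominator is 0 as an \<open>ennreal\<close>. The hypothesis forces
      the numerator to be 0 too, and \<open>0 / 0 = 0\<close>, so \<open>\<rho>1\<close> need not be
      shown to separate points.\<close>
    case False
    then have "\<rho>2 (f x) (f y) \<le> 0"
      using le assms(1) by (meson mult_nonneg_nonpos not_less order_trans)
    then show ?thesis by (simp add: ennreal_neg)
  qed
qed

text \<open>Different samples occupy disjoint blocks of coordinates, so the Lipschitz constants of
  the single characters combine as a root mean square. Nothing is random yet.\<close>

lemma Lip_feature_map_le:
  assumes fin: "finite (- A)" and nu: "0 \<le> nu_total A w t"
    and L: "\<And>r. 0 \<le> L r" "\<And>r u v. u \<in> quot_points A \<Longrightarrow> v \<in> quot_points A \<Longrightarrow>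
      cmod (phase (\<theta> r) u - phase (\<theta> r) v) \<le> L r * d1_bar A u v"
  shows "Lip (K A) (rho A) (euclidean_dist (2 * R)) (feature_map A w t R \<theta>)
    \<le> ennreal (sqrt (nu_total A w t / real R * (\<Sum>r<R. (L r)\<^sup>2)))"
proof (rule Lip_le)
  show "0 \<le> sqrt (nu_total A w t / real R * (\<Sum>r<R. (L r)\<^sup>2))"
    using nu by (simp add: sum_nonneg)
  fix \<alpha> \<beta> assume K: "\<alpha> \<in> K A" "\<beta> \<in> K A"
  have "0 \<le> rho A \<alpha> \<beta>"
    using K by (auto simp: K_eq_differences rho_differences diagrams_add sum_mset_d1_bar_nonneg
        intro!: W1_greatest)
  have "(euclidean_dist (2 * R) (feature_map A w t R \<theta> \<alpha>) (feature_map A w t R \<theta> \<beta>))\<^sup>2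
      \<le> nu_total A w t / real R * (\<Sum>r<R. (L r * rho A \<alpha> \<beta>)\<^sup>2)"
    unfolding euclidean_dist_feature_map[OF nu] using nu
    by (intro mult_left_mono sum_mono power_mono cmod_cis_pairing_diff_le fin L K) auto
  also have "\<dots> = nu_total A w t / real R * (\<Sum>r<R. (L r)\<^sup>2) * (rho A \<alpha> \<beta>)\<^sup>2"
    by (simp add: power_mult_distrib sum_distrib_right sum_distrib_left mult.assoc)
  finally have "euclidean_dist (2 * R) (feature_map A w t R \<theta> \<alpha>) (feature_map A w t R \<theta> \<beta>)
      \<le> sqrt (nu_total A w t / real R * (\<Sum>r<R. (L r)\<^sup>2) * (rho A \<alpha> \<beta>)\<^sup>2)"
    by (rule real_le_rsqrt)
  also have "\<dots> = sqrt (nu_total A w t / real R * (\<Sum>r<R. (L r)\<^sup>2)) * rho A \<alpha> \<beta>"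
    using \<open>0 \<le> rho A \<alpha> \<beta>\<close> by (subst real_sqrt_mult) simp
  finally show "euclidean_dist (2 * R) (feature_map A w t R \<theta> \<alpha>) (feature_map A w t R \<theta> \<beta>)
      \<le> sqrt (nu_total A w t / real R * (\<Sum>r<R. (L r)\<^sup>2)) * rho A \<alpha> \<beta>" .
qed

section \<open>The measure \<open>nu\<close> and its normalization\<close>

text \<open>The energy lies between 0 and a constant, so the density lies between a positive
  constant and 1 on a probability space; the total mass is therefore finite and positive.\<close>

lemma nu_total_eq:
  assumes "0 \<le> t" and "\<And>u v. u \<in> quot_points A \<Longrightarrow> v \<in> quot_points A \<Longrightarrow> 0 \<le> w u v"
  shows "ennreal (nu_total A w t) = (\<integral>\<^sup>+\<theta>. ennreal (exp (- t * energy A w \<theta>)) \<partial>torus (- A))"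
    and "0 < nu_total A w t"
proof -
  interpret T: prob_space "torus (- A)" by (rule prob_space_torus)
  let ?B = "2 * (\<Sum>u\<in>quot_points A. \<Sum>v\<in>quot_points A. w u v)"
  let ?I = "\<integral>\<^sup>+\<theta>. ennreal (exp (- t * energy A w \<theta>)) \<partial>torus (- A)"
  have em: "emeasure (nu A w t) (space (nu A w t)) = ?I"
    unfolding nu_def by (simp add: emeasure_density cong: nn_integral_cong)
  have "?I \<le> (\<integral>\<^sup>+\<theta>. 1 \<partial>torus (- A))"
    using energy_nonneg[of A w] assms by (intro nn_integral_mono) (simp add: mult_nonneg_nonneg)
  \<comment> \<open>\<open>measure\<close> sends infinite mass to 0, so finiteness must come before
    \<open>nu_total\<close> can be identified with the integral.\<close>
  then have fin: "?I < \<top>"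
    by (simp add: T.emeasure_space_1 le_less_trans)
  then show eq: "ennreal (nu_total A w t) = ?I"
    unfolding nu_total_def measure_def em by simp
  have "ennreal (exp (- t * ?B)) = (\<integral>\<^sup>+\<theta>. ennreal (exp (- t * ?B)) \<partial>torus (- A))"
    by (simp add: T.emeasure_space_1)
  also have "\<dots> \<le> ?I"
    using energy_le[of A w] assms by (intro nn_integral_mono ennreal_leI) (simp add: mult_left_mono)
  finally have "0 < ?I"
    by (rule less_le_trans[rotated]) simp
  then show "0 < nu_total A w t"
    unfolding eq[symmetric] by simp
qed

lemma nu_normalized_eq_density:
  assumes "0 < nu_total A w t"
  shows "nu_normalized A w t =
    density (torus (- A)) (\<lambda>\<theta>. ennreal (exp (- t * energy A w \<theta>) / nu_total A w t))"
proof (rule measure_eqI)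
  fix S assume "S \<in> sets (nu_normalized A w t)"
  then have [measurable]: "S \<in> sets (torus (- A))"
    by (simp add: nu_normalized_def nu_def)
  have "emeasure (nu_normalized A w t) S = (1 / ennreal (nu_total A w t)) *
      (\<integral>\<^sup>+\<theta>. ennreal (exp (- t * energy A w \<theta>)) * indicator S \<theta> \<partial>torus (- A))"
    by (simp add: nu_normalized_def nu_def emeasure_density)
  also have "\<dots> = (\<integral>\<^sup>+\<theta>. (1 / ennreal (nu_total A w t)) *
      (ennreal (exp (- t * energy A w \<theta>)) * indicator S \<theta>) \<partial>torus (- A))"
    by (rule nn_integral_cmult[symmetric]) measurable
  also have "\<dots> = (\<integral>\<^sup>+\<theta>. ennreal (exp (- t * energy A w \<theta>) / nu_total A w t) * indicator S \<theta>
      \<partial>torus (- A))"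
  proof (rule nn_integral_cong)
    fix \<theta>
    have "1 / ennreal (nu_total A w t) = ennreal (1 / nu_total A w t)"
      using assms by (simp add: divide_ennreal flip: ennreal_1)
    then show "(1 / ennreal (nu_total A w t)) *
        (ennreal (exp (- t * energy A w \<theta>)) * indicator S \<theta>)
      = ennreal (exp (- t * energy A w \<theta>) / nu_total A w t) * indicator S \<theta>"
      using assms by (simp add: mult.assoc[symmetric] ennreal_mult[symmetric])
  qed
  also have "\<dots> = emeasure (density (torus (- A))
      (\<lambda>\<theta>. ennreal (exp (- t * energy A w \<theta>) / nu_total A w t))) S"
    by (simp add: emeasure_density)
  finally show "emeasure (nu_normalized A w t) S = emeasure (density (torus (- A))
      (\<lambda>\<theta>. ennreal (exp (- t * energy A w \<theta>) / nu_total A w t))) S" .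
qed (simp add: nu_normalized_def nu_def)

text \<open>The normalizing constant cancels. This is why the factor \<open>nu_total\<close> in the
  features leads to an integral against the unnormalized weight.\<close>

lemma integral_nu_normalized:
  fixes f :: "('a \<Rightarrow> real) \<Rightarrow> real"
  assumes "0 < nu_total A w t" and "f \<in> borel_measurable (torus (- A))"
  shows "nu_total A w t * (LINT \<theta>|nu_normalized A w t. f \<theta>)
    = (LINT \<theta>|torus (- A). f \<theta> * exp (- t * energy A w \<theta>))"
proof -
  have "(LINT \<theta>|nu_normalized A w t. f \<theta>)
      = (LINT \<theta>|torus (- A). exp (- t * energy A w \<theta>) / nu_total A w t * f \<theta>)"
    unfolding nu_normalized_eq_density[OF assms(1)]
    using assms by (subst integral_real_density) (auto simp: less_imp_le)
  also have "\<dots> = (LINT \<theta>|torus (- A). (1 / nu_total A w t) * (f \<theta> * exp (- t * energy A w \<theta>)))"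
    by (simp add: mult_ac)
  also have "\<dots> = (1 / nu_total A w t) * (LINT \<theta>|torus (- A). f \<theta> * exp (- t * energy A w \<theta>))"
    by (rule integral_mult_right_zero)
  finally show ?thesis
    using assms(1) by simp
qed

section \<open>Convergence in probability of the root of the empirical mean\<close>

text \<open>One of the two factors \<open>\<bar>sqrt x - sqrt y\<bar>\<close> is enlarged to
  \<open>sqrt x + sqrt y\<close>. Unlike a derivative bound, the estimate survives at
  \<open>y = 0\<close>, so the limiting mean may vanish.\<close>

lemma power2_sqrt_diff_le:
  assumes "0 \<le> x" "0 \<le> y"
  shows "(sqrt x - sqrt y)\<^sup>2 \<le> \<bar>x - y\<bar>"
proof -
  have "(sqrt x - sqrt y)\<^sup>2 = \<bar>sqrt x - sqrt y\<bar> * \<bar>sqrt x - sqrt y\<bar>"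
    by (simp add: power2_eq_square)
  also have "\<dots> \<le> \<bar>sqrt x - sqrt y\<bar> * \<bar>sqrt x + sqrt y\<bar>"
    using real_sqrt_ge_zero[OF assms(1)] real_sqrt_ge_zero[OF assms(2)]
    by (intro mult_left_mono) linarith+
  also have "\<dots> = \<bar>(sqrt x - sqrt y) * (sqrt x + sqrt y)\<bar>"
    by (rule abs_mult[symmetric])
  also have "(sqrt x - sqrt y) * (sqrt x + sqrt y) = x - y"
    using assms by (simp add: algebra_simps)
  finally show ?thesis .
qed

text \<open>The \<open>X n i\<close> form a triangular array: nothing relates different rows, so a
  law of large numbers for one sequence does not apply directly. Hoeffding's inequality treats each
  row alone, and the common bound \<open>b\<close> makes the tail estimate tend to 0.\<close>

lemma sqrt_mean_tendsto_in_probability: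
  fixes X :: "nat \<Rightarrow> nat \<Rightarrow> 'w \<Rightarrow> real"
  assumes "prob_space M"
    and indep: "\<And>n. n \<ge> 1 \<Longrightarrow> prob_space.indep_vars M (\<lambda>_. borel) (X n) {..<n}"
    and bounds: "\<And>n i \<omega>. 0 \<le> X n i \<omega>" "\<And>n i \<omega>. X n i \<omega> \<le> b"
    and mean: "\<And>n i. i < n \<Longrightarrow> (LINT \<omega>|M. X n i \<omega>) = m" and "0 \<le> m"
    and "0 < C"
  shows "tendsto_0_in_probability M (\<lambda>n \<omega>. C * sqrt ((\<Sum>i<n. X n i \<omega>) / real n) - C * sqrt m)"
  unfolding tendsto_0_in_probability_def
proof (intro conjI allI impI)
  interpret prob_space M by fact
  have meas [measurable]: "X n i \<in> borel_measurable M" if "i < n" for n i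
    using indep[of n] that by (auto simp: indep_vars_def)
  show "(\<lambda>\<omega>. C * sqrt ((\<Sum>i<n. X n i \<omega>) / real n) - C * sqrt m) \<in> borel_measurable M" for n
    by measurable
  fix \<epsilon> :: real assume "\<epsilon> > 0"
  \<comment> \<open>By \<open>power2_sqrt_diff_le\<close>, an error above \<open>\<epsilon>\<close>
    after taking roots and scaling by \<open>C\<close> forces the mean itself to be off by at least
    \<open>(\<epsilon> / C)\<^sup>2\<close>.\<close>
  define \<delta> where "\<delta> = (\<epsilon> / C)\<^sup>2"
  \<comment> \<open>Hoeffding's bound divides by the squared range, which would be 0 for
    \<open>b = 0\<close>.\<close>
  define b' where "b' = max b 1"
  have "\<delta> > 0" "b' > 0" using \<open>\<epsilon> > 0\<close> \<open>0 < C\<close> by (simp_all add: \<delta>_def b'_def)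
  let ?P = "\<lambda>n. prob {\<omega> \<in> space M. \<bar>C * sqrt ((\<Sum>i<n. X n i \<omega>) / real n) - C * sqrt m\<bar> > \<epsilon>}"
  have le: "?P n \<le> 2 * exp (- (2 * \<delta>\<^sup>2 / b'\<^sup>2) * real n)" if n: "n \<ge> 1" for n
  proof -
    interpret H: Hoeffding_ineq M "{..<n}" "X n" "\<lambda>_. 0" "\<lambda>_. b'" "real n * m"
    proof unfold_locales
      show "indep_vars (\<lambda>_. borel) (X n) {..<n}" by (rule indep[OF n])
      show "AE \<omega> in M. X n i \<omega> \<in> {0..b'}" for i
        using bounds[of n i] by (simp add: b'_def le_max_iff_disj)
      show "real n * m \<equiv> \<Sum>i<n. expectation (X n i)"
        by (rule eq_reflection) (simp add: mean)
    qed simp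
    have "?P n \<le> prob {\<omega>\<in>space M. \<bar>(\<Sum>i<n. X n i \<omega>) - real n * m\<bar> \<ge> real n * \<delta>}"
    proof (rule finite_measure_mono)
      show "{\<omega>\<in>space M. \<bar>(\<Sum>i<n. X n i \<omega>) - real n * m\<bar> \<ge> real n * \<delta>} \<in> events"
        by measurable
      show "{\<omega> \<in> space M. \<bar>C * sqrt ((\<Sum>i<n. X n i \<omega>) / real n) - C * sqrt m\<bar> > \<epsilon>}
        \<subseteq> {\<omega>\<in>space M. \<bar>(\<Sum>i<n. X n i \<omega>) - real n * m\<bar> \<ge> real n * \<delta>}"
      proof safe
        fix \<omega>
        let ?s = "(\<Sum>i<n. X n i \<omega>) / real n"
        assume "\<epsilon> < \<bar>C * sqrt ?s - C * sqrt m\<bar>"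
        also have "\<dots> = C * \<bar>sqrt ?s - sqrt m\<bar>"
          using \<open>0 < C\<close> by (simp add: abs_mult flip: right_diff_distrib)
        finally have "\<epsilon> / C \<le> \<bar>sqrt ?s - sqrt m\<bar>"
          using \<open>0 < C\<close> by (simp add: field_simps)
        then have "\<delta> \<le> \<bar>sqrt ?s - sqrt m\<bar>\<^sup>2"
          unfolding \<delta>_def using \<open>\<epsilon> > 0\<close> \<open>0 < C\<close> by (intro power_mono) auto
        also have "\<dots> \<le> \<bar>?s - m\<bar>"
          using power2_sqrt_diff_le[of ?s m] bounds(1) \<open>0 \<le> m\<close> by (simp add: sum_nonneg)
        finally have "real n * \<delta> \<le> real n * \<bar>?s - m\<bar>"
          by (intro mult_left_mono) auto
        also have "\<dots> = \<bar>real n * (?s - m)\<bar>"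
          by (simp add: abs_mult)
        also have "real n * (?s - m) = (\<Sum>i<n. X n i \<omega>) - real n * m"
          using n by (simp add: right_diff_distrib)
        finally show "real n * \<delta> \<le> \<bar>(\<Sum>i<n. X n i \<omega>) - real n * m\<bar>" .
      qed
    qed
    also have "\<dots> \<le> 2 * exp (-2 * (real n * \<delta>)\<^sup>2 / (\<Sum>i<n. (b' - 0)\<^sup>2))"
      using n \<open>\<delta> > 0\<close> \<open>b' > 0\<close> by (intro H.Hoeffding_ineq_abs_ge) auto
    \<comment> \<open>The \<open>n\<close> equal ranges sum to \<open>n * b'\<^sup>2\<close>,
      cancelling one of the two factors \<open>n\<close> and leaving exponential decay.\<close>
    also have "-2 * (real n * \<delta>)\<^sup>2 / (\<Sum>i<n. (b' - 0)\<^sup>2) = - (2 * \<delta>\<^sup>2 / b'\<^sup>2) * real n"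
      using n \<open>b' > 0\<close> by (simp add: field_simps power2_eq_square)
    finally show ?thesis .
  qed
  have "(\<lambda>n. 2 * exp (- k * real n)) \<longlonglongrightarrow> 0" if "k > 0" for k :: real
    using that by real_asymp
  from this[of "2 * \<delta>\<^sup>2 / b'\<^sup>2"]
  have lim: "(\<lambda>n. 2 * exp (- (2 * \<delta>\<^sup>2 / b'\<^sup>2) * real n)) \<longlonglongrightarrow> 0"
    using \<open>\<delta> > 0\<close> \<open>b' > 0\<close> by auto
  show "?P \<longlonglongrightarrow> 0"
  proof (rule tendsto_sandwich[OF _ _ tendsto_const lim])
    show "\<forall>\<^sub>F n in sequentially. ?P n \<le> 2 * exp (- (2 * \<delta>\<^sup>2 / b'\<^sup>2) * real n)"
      by (rule eventually_sequentiallyI[of 1]) (rule le)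
  qed simp
qed

section \<open>The Lipschitz bound for random features\<close>

theorem theorem6p6:
  fixes A :: "'a::metric_space set"
    and H :: "'a option pair_pre_digraph"
    and w :: "'a option \<Rightarrow> 'a option \<Rightarrow> real"
    and t w_min d_min :: real
    and M :: "'w measure"
    and \<theta> :: "nat \<Rightarrow> nat \<Rightarrow> 'w \<Rightarrow> 'a \<Rightarrow> real"
  assumes "A \<noteq> {}" and "finite (- A)" and "- A \<noteq> {}"
    and "Metric_space (quot_points A) (d1_bar A)"
    and "pair_graph H" and "pverts H = quot_points A"
    and "Digraph_Component.connected (with_proj H)"
    and "\<And>u v. u \<in> quot_points A \<Longrightarrow> v \<in> quot_points A \<Longrightarrow>
      wf_digraph.\<mu> (with_proj H) (\<lambda>(x, y). d1_bar A x y) u v = ereal (d1_bar A u v)"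
    and "\<And>u v. u \<in> quot_points A \<Longrightarrow> v \<in> quot_points A \<Longrightarrow> w u v = w v u"
    and "\<And>u v. (u, v) \<in> parcs H \<Longrightarrow> w u v > 0"
    and "\<And>u v. u \<in> quot_points A \<Longrightarrow> v \<in> quot_points A \<Longrightarrow> (u, v) \<notin> parcs H \<Longrightarrow> w u v = 0"
    and "w_min = Min ((\<lambda>(u, v). w u v) ` parcs H)"
    and "d_min = Min ((\<lambda>(u, v). d1_bar A u v) ` parcs H)"
    and "t > 0"
    and "prob_space M"
    and "\<And>R. R \<ge> 1 \<Longrightarrow> prob_space.indep_vars M (\<lambda>_. torus (- A)) (\<theta> R) {..<R}"
    and "\<And>R r. r < R \<Longrightarrow> distr M (torus (- A)) (\<theta> R r) = nu_normalized A w t"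
  shows "\<exists>Z :: nat \<Rightarrow> 'w \<Rightarrow> real. tendsto_0_in_probability M Z \<and>
    (\<forall>R\<ge>1. \<forall>\<omega>\<in>space M.
      enn2ereal (Lip (K A) (rho A) (euclidean_dist (2 * R)) (feature_map A w t R (\<lambda>r. \<theta> R r \<omega>)))
      \<le> ereal (pi / (d_min * sqrt (2 * w_min)) *
            sqrt (LINT \<eta>|torus (- A). energy A w \<eta> * exp (- t * energy A w \<eta>))
          + Z R \<omega>))"
proof -
  note fin = assms(2) and mu = assms(8)
  interpret H: pair_graph H by fact
  interpret M: prob_space M by fact
  interpret d: Metric_space "quot_points A" "d1_bar A" by fact
  have arcs: "u \<in> quot_points A" "v \<in> quot_points A" "u \<noteq> v" if "(u, v) \<in> parcs H" for u v
    using that H.in_arcsD1 H.in_arcsD2 H.no_loops' assms(6) by auto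
  \<comment> \<open>Without arcs, the two minima would be unspecified. The distance from the
    basepoint to a point outside \<open>A\<close> is finite, so a walk joins them, and its first
    step is an arc.\<close>
  have "parcs H \<noteq> {}"
  proof
    assume empty: "parcs H = {}"
    obtain x where "x \<notin> A" using assms(3) by auto
    then have x: "None \<in> quot_points A" "Some x \<in> quot_points A"
      by (auto simp: quot_points_def)
    have "H.\<mu> (\<lambda>(x, y). d1_bar A x y) None (Some x) \<noteq> \<infinity>"
      unfolding mu[OF x] by simp
    then have "\<exists>p. H.awalk None p (Some x)"
      using H.shortest_path_inf H.reachable_awalk by blast
    then obtain p where "H.awalk None p (Some x)" ..
    then show False
      by (cases p) (simp_all add: H.awalk_Nil_iff H.awalk_Cons_iff empty)
  qed
  then have "w_min \<in> (\<lambda>(u, v). w u v) ` parcs H" "d_min \<in> (\<lambda>(u, v). d1_bar A u v) ` parcs H"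
    unfolding assms(12,13) by (auto intro!: Min_in H.pair_finite_arcs)
  \<comment> \<open>Both minima are attained at arcs. Arcs join distinct points, where the metric
    \<open>d1_bar\<close> is positive.\<close>
  then have pos: "w_min > 0" "d_min > 0"
    using assms(10) arcs by (auto simp only: d.mdist_pos_eq)
  have min_le: "w_min \<le> w u v" "d_min \<le> d1_bar A u v" if "(u, v) \<in> parcs H" for u v
    unfolding assms(12,13) using that H.pair_finite_arcs by (auto intro!: Min_le)
  have w: "0 \<le> w u v" if "u \<in> quot_points A" "v \<in> quot_points A" for u v
    using assms(10)[of u v] assms(11)[OF that] by (cases "(u, v) \<in> parcs H") auto
  define C where "C = pi / (d_min * sqrt (2 * w_min))"
  have C: "0 < C" using pos by (simp add: C_def)
  have en: "0 \<le> energy A w \<eta>" for \<eta>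
    by (intro energy_nonneg w)
  have lip: "cmod (phase \<eta> u - phase \<eta> v) \<le> C * sqrt (energy A w \<eta>) * d1_bar A u v"
    if uv: "u \<in> quot_points A" "v \<in> quot_points A" for \<eta> u v
  proof -
    \<comment> \<open>Arcs suffice: the shortest-path metric is \<open>d1_bar\<close>, so the same
      constant then serves all pairs.\<close>
    have "dist (phase \<eta> x) (phase \<eta> y) \<le> C * sqrt (energy A w \<eta>) * d1_bar A x y"
      if xy: "(x, y) \<in> parcs H" for x y
    proof -
      let ?c = "cmod (phase \<eta> x - phase \<eta> y)"
      have "w_min * ?c\<^sup>2 \<le> w x y * ?c\<^sup>2"
        using min_le[OF xy] by (simp add: mult_right_mono)
      also have "\<dots> \<le> 2 * energy A w \<eta>"
        using arcs[OF xy] by (intro edge_term_le_energy fin w)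
      finally have "2 * w_min * ?c\<^sup>2 \<le> 4 * energy A w \<eta>" by simp
      then have "sqrt (2 * w_min * ?c\<^sup>2) \<le> sqrt (4 * energy A w \<eta>)"
        by simp
      then have "sqrt (2 * w_min) * ?c \<le> 2 * sqrt (energy A w \<eta>)"
        by (simp add: real_sqrt_mult)
      also have "\<dots> \<le> pi * sqrt (energy A w \<eta>)"
        using pi_ge_two en by (intro mult_right_mono) auto
      finally have "?c \<le> C * sqrt (energy A w \<eta>) * d_min"
        using pos by (simp add: C_def field_simps)
      also have "\<dots> \<le> C * sqrt (energy A w \<eta>) * d1_bar A x y"
        using min_le[OF xy] C en by (intro mult_left_mono) auto
      finally show ?thesis by (simp add: dist_norm)
    qed
    moreover have "0 \<le> C * sqrt (energy A w \<eta>)"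
      using C en by simp
    ultimately have "dist (phase \<eta> u) (phase \<eta> v) \<le> C * sqrt (energy A w \<eta>) * d1_bar A u v"
      by (intro H.dist_le_mult_shortest_path[OF _ _ mu[OF uv]]) simp_all
    then show ?thesis by (simp add: dist_norm)
  qed
  have nu: "0 < nu_total A w t"
    using assms(14) by (intro nu_total_eq w) auto
  define I where "I = (LINT \<eta>|torus (- A). energy A w \<eta> * exp (- t * energy A w \<eta>))"
  \<comment> \<open>The factor \<open>nu_total\<close> makes the expectation of each
    \<open>X R r\<close> exactly \<open>I\<close>.\<close>
  define X where "X R r \<omega> = nu_total A w t * energy A w (\<theta> R r \<omega>)" for R r \<omega>
  \<comment> \<open>\<open>Z\<close> is the deviation of the sample bound from its limit, so the
    final inequality holds at every \<open>\<omega>\<close>; only the smallness of \<open>Z\<close>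
    is probabilistic.\<close>
  define Z where "Z R \<omega> = C * sqrt ((\<Sum>r<R. X R r \<omega>) / real R) - C * sqrt I" for R \<omega>
  have "tendsto_0_in_probability M Z"
    unfolding Z_def
  proof (rule sqrt_mean_tendsto_in_probability)
    show "prob_space M" by fact
    show "0 \<le> I"
      unfolding I_def using en by (intro Bochner_Integration.integral_nonneg) simp
    show "M.indep_vars (\<lambda>_. borel) (X R) {..<R}" if "R \<ge> 1" for R
      unfolding X_def
      by (rule M.indep_vars_compose2[OF assms(16)[OF that]]) measurable
    show "0 \<le> X R r \<omega>" for R r \<omega>
      using nu en by (simp add: X_def)
    show "X R r \<omega> \<le> nu_total A w t * (2 * (\<Sum>u\<in>quot_points A. \<Sum>v\<in>quot_points A. w u v))"
      for R r \<omega>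
      unfolding X_def using nu by (intro mult_left_mono energy_le w) auto
    show "(LINT \<omega>|M. X R r \<omega>) = I" if "r < R" for R r
    proof -
      have "\<theta> R r \<in> measurable M (torus (- A))"
        using assms(16)[of R] that by (auto simp: M.indep_vars_def)
      then have "(LINT \<omega>|M. energy A w (\<theta> R r \<omega>)) = (LINT \<eta>|nu_normalized A w t. energy A w \<eta>)"
        unfolding assms(17)[OF that, symmetric] by (simp add: integral_distr)
      then show ?thesis
        using integral_nu_normalized[OF nu, of "energy A w"] by (simp add: X_def I_def)
    qed
  qed (fact C)
  moreover have "enn2ereal (Lip (K A) (rho A) (euclidean_dist (2 * R))
      (feature_map A w t R (\<lambda>r. \<theta> R r \<omega>))) \<le> ereal (C * sqrt I + Z R \<omega>)" for R \<omega>
  proof -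
    let ?L = "\<lambda>r. C * sqrt (energy A w (\<theta> R r \<omega>))"
    have "Lip (K A) (rho A) (euclidean_dist (2 * R)) (feature_map A w t R (\<lambda>r. \<theta> R r \<omega>))
        \<le> ennreal (sqrt (nu_total A w t / real R * (\<Sum>r<R. (?L r)\<^sup>2)))"
      using nu C en lip by (intro Lip_feature_map_le fin) auto
    also have "nu_total A w t / real R * (\<Sum>r<R. (?L r)\<^sup>2) = C\<^sup>2 * ((\<Sum>r<R. X R r \<omega>) / real R)"
      using en by (simp add: X_def power_mult_distrib sum_distrib_left sum_divide_distrib mult_ac)
    also have "sqrt \<dots> = C * sqrt I + Z R \<omega>"
      unfolding Z_def using C by (subst real_sqrt_mult) simp
    finally have "enn2ereal (Lip (K A) (rho A) (euclidean_dist (2 * R))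
        (feature_map A w t R (\<lambda>r. \<theta> R r \<omega>))) \<le> enn2ereal (ennreal (C * sqrt I + Z R \<omega>))"
      by (simp add: less_eq_ennreal.rep_eq)
    \<comment> \<open>\<open>Z\<close> may be negative, but the sum is \<open>C\<close> times the
      root of a nonnegative mean, so the conversion through \<open>ennreal\<close> does not truncate
      it.\<close>
    also have "\<dots> = ereal (C * sqrt I + Z R \<omega>)"
      using C nu en by (intro enn2ereal_ennreal) (simp add: Z_def X_def sum_nonneg)
    finally show ?thesis .
  qed
  ultimately show ?thesis
    unfolding C_def I_def by blast
qed

end
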